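(* Let $R$ be a commutative ring with identity containing $\mathbb{Q}$ and let $N\ge2$ be an integer. For every $p\in R[X_1,\ldots,X_N]$ that is homogeneous of degree $d$, $$\lambda_0(X_1p)=\frac{1}{N+d-1}\,\lambda_0(\partial_1p).$$
   Context: $\partial_j=\partial/\partial X_j$ and $M_{jk}=X_j\partial_k-X_k\partial_j$ for distinct $j,k\in\{1,\ldots,N\}$. $\lambda_0\colon R[X_1,\ldots,X_N]\to R$ denotes the unique $R$-linear map such that $\lambda_0\circ M_{jk}=0$ for all $j\ne k$ and $\lambda_0\bigl((X_1^2+\cdots+X_N^2)^n\bigr)=1$ for all integers $n\ge0$ (it exists and is unique). *)

theory Defs
  imports Complex_Main "HOL-Library.Poly_Mapping" "HOL-Library.Cardinality"
begin

text \<open>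
  The polynomial ring \<open>R[X\<^sub>1, \<dots>, X\<^sub>N]\<close>: finitely supported functions from exponent vectors to
  coefficients.  The variables are indexed by a finite type \<open>'n\<close>, so \<open>N = CARD('n)\<close>.
  Multiplication is the convolution product provided by the library.
\<close>
type_synonym ('n, 'r) mpoly = "('n \<Rightarrow>\<^sub>0 nat) \<Rightarrow>\<^sub>0 'r"

definition Var :: "'n \<Rightarrow> ('n, 'r::comm_ring_1) mpoly" where
  "Var j = Poly_Mapping.single (Poly_Mapping.single j 1) 1"

definition smult :: "'r::comm_ring_1 \<Rightarrow> ('n, 'r) mpoly \<Rightarrow> ('n, 'r) mpoly" where
  "smult c p = Poly_Mapping.single 0 c * p"

text \<open>
  The subtraction of exponents truncates, but only in terms whose coefficient is 0.
\<close>
definition pd :: "'n \<Rightarrow> ('n, 'r::comm_ring_1) mpoly \<Rightarrow> ('n, 'r) mpoly" where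
  "pd j p = (\<Sum>m\<in>Poly_Mapping.keys p.
     Poly_Mapping.single (m - Poly_Mapping.single j 1)
       (of_nat (Poly_Mapping.lookup m j) * Poly_Mapping.lookup p m))"

text \<open>The zero polynomial is homogeneous of every degree.\<close>
definition homogeneous :: "nat \<Rightarrow> ('n::finite, 'r::comm_ring_1) mpoly \<Rightarrow> bool" where
  "homogeneous d p \<longleftrightarrow>
     (\<forall>m\<in>Poly_Mapping.keys p. (\<Sum>j\<in>UNIV. Poly_Mapping.lookup m j) = d)"

definition M :: "'n \<Rightarrow> 'n \<Rightarrow> ('n, 'r::comm_ring_1) mpoly \<Rightarrow> ('n, 'r) mpoly" where
  "M j k p = Var j * pd k p - Var k * pd j p"

definition is_lambda0 :: "(('n::finite, 'r::comm_ring_1) mpoly \<Rightarrow> 'r) \<Rightarrow> bool" where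
  "is_lambda0 L \<longleftrightarrow>
     module_hom smult (*) L \<and>
     (\<forall>j k. j \<noteq> k \<longrightarrow> (\<forall>p. L (M j k p) = 0)) \<and>
     (\<forall>n::nat. L ((\<Sum>j\<in>UNIV. Var j ^ 2) ^ n) = 1)"

text \<open>
  Existence and uniqueness hold if \<open>N \<ge> 2\<close> and \<open>R\<close> contains the rationals; otherwise the
  value may be unspecified.
\<close>
definition lambda0 :: "('n::finite, 'r::comm_ring_1) mpoly \<Rightarrow> 'r" where
  "lambda0 = (THE L. is_lambda0 L)"

text \<open>
  An embedding of the field of rationals as a unital subring.  There is at most one such
  embedding into a given ring; it gives meaning to rational scalars.
\<close>
definition rat_embedding :: "(rat \<Rightarrow> 'r::comm_ring_1) \<Rightarrow> bool" where
  "rat_embedding \<iota> \<longleftrightarrow>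
     inj \<iota> \<and> \<iota> 1 = 1 \<and> (\<forall>x y. \<iota> (x + y) = \<iota> x + \<iota> y) \<and> (\<forall>x y. \<iota> (x * y) = \<iota> x * \<iota> y)"

end

theory Submission
  imports Defs
begin

text \<open>
  Existence: on a monomial of degree \<open>d\<close> take its Gaussian moment divided by \<open>N (N + 2) \<dots> (N + d - 2)\<close>.
  The recursions of the two factors give the claimed formula for this functional.  The formula
  turns the vanishing on the images of the \<open>M\<^sub>j\<^sub>k\<close> into the commutation of \<open>\<partial>\<^sub>j\<close> and \<open>\<partial>\<^sub>k\<close>,
  and, by Euler's identity, the value 1 at the powers of \<open>r\<^sup>2\<close> into an induction on the exponent.

  Uniqueness: for \<open>p\<close> homogeneous of degree \<open>d\<close>,
  \<open>\<Sum>\<^sub>k M\<^sub>i\<^sub>k (X\<^sub>k p) = (N + d - 1) X\<^sub>i p - r\<^sup>2 \<partial>\<^sub>i p\<close>, and the \<open>M\<^sub>j\<^sub>k\<close> are derivations that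
  kill \<open>r\<^sup>2\<close>, so any such functional at \<open>r\<^sup>2\<^sup>n X\<^sub>i p\<close> is determined by its value at \<open>r\<^sup>2\<^sup>n\<^sup>+\<^sup>2 \<partial>\<^sub>i p\<close>.
\<close>

section \<open>Reduction to monomials; partial derivatives as commuting derivations\<close>

lemma poly_mapping_eq_sum_single:
  fixes p :: "'a \<Rightarrow>\<^sub>0 'b::comm_monoid_add"
  shows "p = (\<Sum>m\<in>Poly_Mapping.keys p. Poly_Mapping.single m (Poly_Mapping.lookup p m))"
  by (rule poly_mapping_eqI)
    (auto simp: lookup_sum lookup_single when_def in_keys_iff sum.delta)

text \<open>The \<open>single\<close> case keeps \<open>m\<close> among the keys of
  \<open>p\<close>, so that a property of all exponents of \<open>p\<close>, such as their degree,
  survives the induction.\<close>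

lemma poly_mapping_single_induct [case_names zero single add]:
  fixes p :: "'a \<Rightarrow>\<^sub>0 'b::comm_monoid_add"
  assumes zero: "P 0"
    and single: "\<And>m c. m \<in> Poly_Mapping.keys p \<Longrightarrow> P (Poly_Mapping.single m c)"
    and add: "\<And>q r. P q \<Longrightarrow> P r \<Longrightarrow> P (q + r)"
  shows "P p"
proof -
  have "P (\<Sum>m\<in>A. Poly_Mapping.single m (Poly_Mapping.lookup p m))"
    if "finite A" "A \<subseteq> Poly_Mapping.keys p" for A
    using that by (induction A) (auto intro: zero single add)
  from this[OF finite_keys order_refl] show ?thesis
    by (simp flip: poly_mapping_eq_sum_single)
qed

lemma pd_zero [simp]: "pd j 0 = 0"
  by (simp add: pd_def)

lemma pd_add: "pd j (p + q) = pd j p + pd j q"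
  unfolding pd_def
  by (rule setsum_keys_plus_distrib) (auto simp: distrib_left single_add)

lemma pd_sum: "pd j (\<Sum>x\<in>A. f x) = (\<Sum>x\<in>A. pd j (f x))"
  by (induction A rule: infinite_finite_induct) (auto simp: pd_add)

lemma pd_single:
  "pd j (Poly_Mapping.single m c) =
    Poly_Mapping.single (m - Poly_Mapping.single j 1) (of_nat (Poly_Mapping.lookup m j) * c)"
  by (simp add: pd_def)

lemma pd_one [simp]: "pd j 1 = 0"
  using pd_single[of j 0 1] by simp

lemma minus_single_add:
  fixes m :: "'n \<Rightarrow>\<^sub>0 nat"
  assumes "Poly_Mapping.lookup m j > 0"
  shows "m + n - Poly_Mapping.single j 1 = m - Poly_Mapping.single j 1 + n"
  using assms by (intro poly_mapping_eqI) (auto simp: lookup_add lookup_minus lookup_single when_def)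

lemma pd_mult_single:
  fixes c c' :: "'r::comm_ring_1"
  shows "pd j (Poly_Mapping.single m c * Poly_Mapping.single m' c') =
    pd j (Poly_Mapping.single m c) * Poly_Mapping.single m' c' +
    Poly_Mapping.single m c * pd j (Poly_Mapping.single m' c')"
proof -
  let ?e = "Poly_Mapping.single j (1::nat)"
  \<comment> \<open>If the exponent of \<open>j\<close> is 0, truncation may make the two exponent
    vectors differ, but both coefficients are then 0.\<close>
  have 1: "Poly_Mapping.single (m + m' - ?e) (of_nat (Poly_Mapping.lookup m j) * c * c') =
     Poly_Mapping.single (m - ?e + m') (of_nat (Poly_Mapping.lookup m j) * c * c')"
    using minus_single_add[of m j m']
    by (cases "Poly_Mapping.lookup m j = 0") auto
  have 2: "Poly_Mapping.single (m + m' - ?e) (of_nat (Poly_Mapping.lookup m' j) * c * c') =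
     Poly_Mapping.single (m + (m' - ?e)) (of_nat (Poly_Mapping.lookup m' j) * c * c')"
    using minus_single_add[of m' j m]
    by (cases "Poly_Mapping.lookup m' j = 0") (auto simp: add.commute)
  show ?thesis
    using 1 2
    by (simp add: pd_single mult_single lookup_add algebra_simps single_add)
qed

lemma pd_mult: "pd j (p * q) = pd j p * q + p * pd j q"
proof (induction p rule: poly_mapping_single_induct)
  case (single m c)
  show ?case
    by (induction q rule: poly_mapping_single_induct)
      (auto simp: pd_mult_single pd_add algebra_simps)
qed (auto simp: pd_add algebra_simps)

lemma pd_Var: "pd j (Var k) = (if j = k then 1 else 0)"
  by (auto simp: Var_def pd_single lookup_single)

lemma pd_commute: "pd j (pd k p) = pd k (pd j p)"
proof (induction p rule: poly_mapping_single_induct)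
  case (single m c)
  show ?case
    by (cases "j = k")
      (simp_all add: pd_single lookup_minus lookup_single mult_ac diff_diff_eq add.commute)
qed (auto simp: pd_add)

section \<open>Degree, homogeneity and Euler's identity\<close>

abbreviation mdeg :: "('n::finite \<Rightarrow>\<^sub>0 nat) \<Rightarrow> nat" where
  "mdeg m \<equiv> \<Sum>j\<in>UNIV. Poly_Mapping.lookup m j"

lemma homogeneous_single: "mdeg m = d \<Longrightarrow> homogeneous d (Poly_Mapping.single m c)"
  by (auto simp: homogeneous_def split: if_splits)

lemma homogeneous_zero [simp]: "homogeneous d 0"
  by (simp add: homogeneous_def)

lemma homogeneous_add: "homogeneous d p \<Longrightarrow> homogeneous d q \<Longrightarrow> homogeneous d (p + q)"
  using keys_add[of p q] by (auto simp: homogeneous_def)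

lemma homogeneous_sum: "(\<And>x. x \<in> A \<Longrightarrow> homogeneous d (f x)) \<Longrightarrow> homogeneous d (\<Sum>x\<in>A. f x)"
  by (induction A rule: infinite_finite_induct) (auto simp: homogeneous_add)

lemma homogeneous_induct [consumes 1, case_names zero single add]:
  assumes "homogeneous d p" and "P 0"
    and "\<And>m c. mdeg m = d \<Longrightarrow> P (Poly_Mapping.single m c)"
    and "\<And>q r. P q \<Longrightarrow> P r \<Longrightarrow> P (q + r)"
  shows "P p"
proof (rule poly_mapping_single_induct)
  show "P (Poly_Mapping.single m c)" if "m \<in> Poly_Mapping.keys p" for m c
    using assms(1,3) that by (simp add: homogeneous_def)
qed (use assms in auto)

lemma mdeg_single: "mdeg (Poly_Mapping.single j a) = a"
  by (simp add: lookup_single when_def)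

lemma mdeg_add: "mdeg (m + n) = mdeg m + mdeg n"
  by (simp add: lookup_add sum.distrib)

lemma homogeneous_mult:
  assumes "homogeneous d p" "homogeneous e q"
  shows "homogeneous (d + e) (p * q)"
  using keys_mult[of p q] assms by (fastforce simp: homogeneous_def lookup_add sum.distrib)

lemma homogeneous_Var [simp]: "homogeneous 1 (Var j)"
  unfolding Var_def by (intro homogeneous_single mdeg_single)

lemma homogeneous_one [simp]: "homogeneous 0 1"
  by (simp add: homogeneous_def)

lemma homogeneous_power: "homogeneous d p \<Longrightarrow> homogeneous (n * d) (p ^ n)"
  by (induction n) (auto intro: homogeneous_mult)

lemma diff_single_add_single:
  fixes m :: "'n \<Rightarrow>\<^sub>0 nat"
  assumes "Poly_Mapping.lookup m j > 0"
  shows "m - Poly_Mapping.single j 1 + Poly_Mapping.single j 1 = m"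
  using assms by (intro poly_mapping_eqI) (auto simp: lookup_add lookup_minus lookup_single when_def)

text \<open>Truncation at \<open>d = 0\<close> is harmless: all exponents are then 0, so the
  derivative is the zero polynomial.\<close>

lemma homogeneous_pd:
  assumes "homogeneous d p"
  shows "homogeneous (d - 1) (pd j p)"
  using assms
proof (induction rule: homogeneous_induct)
  case (single m c)
  show ?case
  proof (cases "Poly_Mapping.lookup m j = 0")
    case False
    then have "mdeg (m - Poly_Mapping.single j 1) + 1 = d"
      using single mdeg_add[of "m - Poly_Mapping.single j 1" "Poly_Mapping.single j 1"]
      by (simp only: diff_single_add_single mdeg_single neq0_conv)
    then show ?thesis
      unfolding pd_single by (intro homogeneous_single) simp
  qed (simp add: pd_single)
qed (auto simp: pd_add homogeneous_add)

lemma euler_identity: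
  assumes "homogeneous d p"
  shows "(\<Sum>j\<in>UNIV. Var j * pd j p) = of_nat d * p"
  using assms
proof (induction rule: homogeneous_induct)
  case (single m c)
  \<comment> \<open>Each summand scales the monomial by one of its exponents, and the exponents add
    up to \<open>d\<close>.\<close>
  have "Var j * pd j (Poly_Mapping.single m c) =
      of_nat (Poly_Mapping.lookup m j) * Poly_Mapping.single m c" for j
    using diff_single_add_single[of m j]
    by (cases "Poly_Mapping.lookup m j = 0")
      (simp_all add: Var_def pd_single mult_single add.commute flip: single_of_nat)
  then show ?case
    using single by (simp flip: sum_distrib_right of_nat_sum)
qed (auto simp: pd_add algebra_simps sum.distrib)

section \<open>The squared radius and the operators \<open>M j k\<close>\<close>

abbreviation r2 :: "('n::finite, 'r::comm_ring_1) mpoly" where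
  "r2 \<equiv> \<Sum>j\<in>UNIV. Var j ^ 2"

lemma homogeneous_r2: "homogeneous (n * 2) (r2 ^ n)"
  by (intro homogeneous_power homogeneous_sum)
    (metis homogeneous_power homogeneous_Var mult.right_neutral)

lemma pd_r2: "pd j r2 = 2 * Var j"
  by (simp add: pd_sum power2_eq_square pd_mult pd_Var if_distrib if_distribR cong: if_cong)

lemma M_mult: "M j k (p * q) = M j k p * q + p * M j k q"
  by (simp add: M_def pd_mult algebra_simps)

lemma M_r2: "M j k r2 = 0"
  unfolding M_def pd_r2 by (simp add: algebra_simps)

lemma M_r2_power: "M j k (r2 ^ n) = 0"
proof (induction n)
  case (Suc n)
  then show ?case by (simp only: power_Suc M_mult M_r2) simp
qed (simp add: M_def)

text \<open>The product rule yields \<open>N - 1\<close> copies of \<open>Var i * p\<close>, and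
  Euler's identity yields \<open>d\<close> more. The terms missing at \<open>k = i\<close> in the
  two remaining sums are both \<open>Var i ^ 2 * pd i p\<close>, with opposite signs, and
  cancel.\<close>

lemma sum_M:
  fixes p :: "('n::finite, 'r::comm_ring_1) mpoly"
  assumes "homogeneous d p"
  shows "(\<Sum>k\<in>UNIV-{i}. M i k (Var k * p)) =
    of_nat (CARD('n) + d - 1) * (Var i * p) - r2 * pd i p"
proof -
  obtain n where N: "CARD('n) = Suc n"
    using not0_implies_Suc[of "CARD('n)"] by auto
  have "(\<Sum>k\<in>UNIV-{i}. M i k (Var k * p)) =
    (\<Sum>k\<in>UNIV-{i}. Var i * p + Var i * (Var k * pd k p) - Var k ^ 2 * pd i p)"
    by (intro sum.cong refl)
      (auto simp: M_def pd_mult pd_Var power2_eq_square distrib_left mult.assoc mult.left_commute)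
  also have "\<dots> = of_nat (CARD('n) - 1) * (Var i * p) +
      (Var i * (\<Sum>k\<in>UNIV-{i}. Var k * pd k p) - (\<Sum>k\<in>UNIV-{i}. Var k ^ 2) * pd i p)"
    by (simp add: sum.distrib sum_subtractf sum_distrib_left sum_distrib_right)
  also have "(\<Sum>k\<in>UNIV-{i}. Var k * pd k p) = of_nat d * p - Var i * pd i p"
    unfolding euler_identity[OF assms, symmetric] by (simp add: sum_diff1)
  also have "(\<Sum>k\<in>UNIV-{i}. Var k ^ 2) = r2 - Var i ^ 2"
    by (simp add: sum_diff1)
  finally show ?thesis
    by (simp add: N algebra_simps power2_eq_square)
qed

section \<open>Positive integers are units of \<open>R\<close>\<close>

lemma rat_embedding_of_nat:
  fixes \<iota> :: "rat \<Rightarrow> 'r::comm_ring_1"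
  assumes "rat_embedding \<iota>"
  shows "\<iota> (of_nat n) = of_nat n"
proof -
  have "\<iota> 0 = 0" using assms unfolding rat_embedding_def by (metis add_cancel_right_right)
  with assms show ?thesis by (induction n) (auto simp: rat_embedding_def)
qed

lemma rat_embedding_inverse:
  fixes \<iota> :: "rat \<Rightarrow> 'r::comm_ring_1"
  assumes "rat_embedding \<iota>" "n > 0"
  shows "\<iota> (1 / of_nat n) * of_nat n = 1"
proof -
  have "\<iota> (1 / of_nat n * of_nat n) = \<iota> (1 / of_nat n) * \<iota> (of_nat n)"
    using assms unfolding rat_embedding_def by blast
  with assms show ?thesis by (simp add: rat_embedding_of_nat rat_embedding_def)
qed

text \<open>\<open>R\<close> may have zero divisors, but \<open>\<iota> (1 / of_nat n)\<close> is an
  inverse of \<open>of_nat n\<close>.\<close>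

lemma rat_embedding_cancel:
  fixes \<iota> :: "rat \<Rightarrow> 'r::comm_ring_1" and a b :: 'r
  assumes "rat_embedding \<iota>" "n > 0" "of_nat n * a = of_nat n * b"
  shows "a = b"
  by (metis assms rat_embedding_inverse mult.assoc mult.left_neutral)

section \<open>Uniqueness of the functional\<close>

context
  fixes L :: "('n::finite, 'r::comm_ring_1) mpoly \<Rightarrow> 'r"
  assumes L: "is_lambda0 L"
begin

lemma is_lambda0_add: "L (p + q) = L p + L q"
  and is_lambda0_scale: "L (Poly_Mapping.single 0 c * p) = c * L p"
  and is_lambda0_M: "j \<noteq> k \<Longrightarrow> L (M j k p) = 0"
  and is_lambda0_r2_power: "L (r2 ^ n) = 1"
  using L
  by (auto simp: is_lambda0_def module_hom_def module_hom_axioms_def smult_def)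

lemma is_lambda0_zero: "L 0 = 0"
  using is_lambda0_scale[of 0 0] by simp

lemma is_lambda0_of_nat: "L (of_nat n * p) = of_nat n * L p"
  using is_lambda0_scale[of "of_nat n" p] by simp

lemma is_lambda0_diff: "L (p - q) = L p - L q"
  using is_lambda0_add[of "p - q" q] by simp

lemma is_lambda0_sum: "L (\<Sum>x\<in>A. f x) = (\<Sum>x\<in>A. L (f x))"
  by (induction A rule: infinite_finite_induct) (auto simp: is_lambda0_add is_lambda0_zero)

text \<open>Since \<open>M i k\<close> kills powers of \<open>r2\<close>, multiplying the identity
  \<open>sum_M\<close> by \<open>r2 ^ n\<close> still gives a sum of images of the
  \<open>M i k\<close>, on which \<open>L\<close> vanishes.\<close>

lemma is_lambda0_Var_mult:
  assumes "homogeneous d p"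
  shows "of_nat (CARD('n) + d - 1) * L (r2 ^ n * (Var i * p)) = L (r2 ^ Suc n * pd i p)"
proof -
  have "0 = (\<Sum>k\<in>UNIV-{i}. L (M i k (r2 ^ n * (Var k * p))))"
    by (intro sum.neutral[symmetric] ballI is_lambda0_M) auto
  also have "\<dots> = L (\<Sum>k\<in>UNIV-{i}. r2 ^ n * M i k (Var k * p))"
    by (simp only: is_lambda0_sum M_mult M_r2_power mult_zero_left add_0_left)
  also have "(\<Sum>k\<in>UNIV-{i}. r2 ^ n * M i k (Var k * p)) =
      r2 ^ n * (of_nat (CARD('n) + d - 1) * (Var i * p) - r2 * pd i p)"
    by (simp only: sum_M[OF assms] flip: sum_distrib_left)
  also have "\<dots> = of_nat (CARD('n) + d - 1) * (r2 ^ n * (Var i * p)) - r2 ^ Suc n * pd i p"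
    by (simp add: algebra_simps)
  finally show ?thesis
    by (simp only: is_lambda0_diff is_lambda0_of_nat) simp
qed

end

text \<open>
  Lowering the degree of the monomial by 2 costs a factor \<open>r\<^sup>2\<close>; hence the induction carries an
  arbitrary power of it.
\<close>
lemma is_lambda0_unique_single:
  fixes \<iota> :: "rat \<Rightarrow> 'r::comm_ring_1" and L L' :: "('n::finite, 'r) mpoly \<Rightarrow> 'r"
  assumes \<iota>: "rat_embedding \<iota>" and N: "CARD('n) \<ge> 2"
    and L: "is_lambda0 L" and L': "is_lambda0 L'"
  shows "L (r2 ^ n * Poly_Mapping.single m c) = L' (r2 ^ n * Poly_Mapping.single m c)"
proof (induction "mdeg m" arbitrary: n m c rule: less_induct)
  case less
  show ?case
  proof (cases "m = 0")
    case True
    then show ?thesis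
      by (simp add: is_lambda0_scale[OF L] is_lambda0_scale[OF L'] mult.commute[of "_ ^ _"]
          is_lambda0_r2_power[OF L] is_lambda0_r2_power[OF L'])
  next
    case False
    then obtain i where i: "Poly_Mapping.lookup m i > 0"
      by (metis gr0I lookup_zero poly_mapping_eqI)
    define m' where "m' = m - Poly_Mapping.single i 1"
    define q where "q = Poly_Mapping.single m' c"
    have m: "m = Poly_Mapping.single i 1 + m'"
      using diff_single_add_single[OF i] by (simp add: m'_def add.commute)
    have q: "Poly_Mapping.single m c = Var i * q"
      by (simp add: q_def Var_def mult_single m)
    have deg: "mdeg m = Suc (mdeg m')"
      unfolding m mdeg_add mdeg_single by simp
    have hom: "homogeneous (mdeg m') q"
      unfolding q_def by (rule homogeneous_single) simp
    \<comment> \<open>Either \<open>m'\<close> no longer contains the variable \<open>i\<close> and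
      the derivative is 0, or the derivative is a monomial of degree two below that of
      \<open>m\<close>, and the induction hypothesis applies with exponent
      \<open>Suc n\<close>.\<close>
    have pd: "L (r2 ^ Suc n * pd i q) = L' (r2 ^ Suc n * pd i q)"
    proof (cases "Poly_Mapping.lookup m' i = 0")
      case True
      then show ?thesis
        by (simp add: q_def pd_single is_lambda0_zero[OF L] is_lambda0_zero[OF L'])
    next
      case False
      then have "mdeg (m' - Poly_Mapping.single i 1) + 1 = mdeg m'"
        by (metis diff_single_add_single mdeg_add mdeg_single neq0_conv)
      then show ?thesis
        unfolding q_def pd_single by (intro less) (simp add: deg)
    qed
    show ?thesis
      unfolding q
    proof (rule rat_embedding_cancel[OF \<iota>])
      \<comment> \<open>\<open>N \<ge> 2\<close> keeps this factor positive even when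
        \<open>m'\<close> is 0.\<close>
      show "CARD('n) + mdeg m' - 1 > 0" using N by simp
    qed (simp only: is_lambda0_Var_mult[OF L hom] is_lambda0_Var_mult[OF L' hom] pd)
  qed
qed

lemma is_lambda0_unique:
  fixes \<iota> :: "rat \<Rightarrow> 'r::comm_ring_1" and L L' :: "('n::finite, 'r) mpoly \<Rightarrow> 'r"
  assumes "rat_embedding \<iota>" "CARD('n) \<ge> 2" and L: "is_lambda0 L" and L': "is_lambda0 L'"
  shows "L = L'"
proof
  fix p
  show "L p = L' p"
  proof (induction p rule: poly_mapping_single_induct)
    case (single m c)
    show ?case using is_lambda0_unique_single[OF assms, of 0 m c] by simp
  qed (auto simp: is_lambda0_zero[OF L] is_lambda0_zero[OF L']
      is_lambda0_add[OF L] is_lambda0_add[OF L'])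
qed

section \<open>Existence: the mean over the unit sphere\<close>

fun gauss_moment :: "nat \<Rightarrow> rat" where
  "gauss_moment 0 = 1"
| "gauss_moment (Suc 0) = 0"
| "gauss_moment (Suc (Suc n)) = of_nat (Suc n) * gauss_moment n"

text \<open>The value at 1 is immaterial, as monomials of odd degree have Gaussian moment 0.\<close>
fun radial_moment :: "nat \<Rightarrow> nat \<Rightarrow> rat" where
  "radial_moment N 0 = 1"
| "radial_moment N (Suc 0) = 1"
| "radial_moment N (Suc (Suc d)) = of_nat (N + d) * radial_moment N d"

text \<open>The mean of the monomial over the real unit sphere: a standard Gaussian vector has
  independent length and direction, and for even degree the denominator is the corresponding moment
  of its length.\<close>

definition sphere_moment :: "('n::finite \<Rightarrow>\<^sub>0 nat) \<Rightarrow> rat" where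
  "sphere_moment m =
    (\<Prod>j\<in>UNIV. gauss_moment (Poly_Mapping.lookup m j)) / radial_moment CARD('n) (mdeg m)"

lemma prod_gauss_moment_add_single:
  "(\<Prod>j\<in>UNIV. gauss_moment (Poly_Mapping.lookup (m + Poly_Mapping.single i a) j)) =
    gauss_moment (Poly_Mapping.lookup m i + a) *
    (\<Prod>j\<in>UNIV-{i::'n::finite}. gauss_moment (Poly_Mapping.lookup m j))"
  by (subst prod.remove[of UNIV i])
    (auto simp: lookup_add lookup_single when_def intro!: prod.cong arg_cong2[where f = "(*)"])

text \<open>Passing from exponent \<open>m_i - 1\<close> to \<open>m_i + 1\<close> multiplies the
  Gaussian moment by \<open>m_i\<close> and the radial moment by
  \<open>N + mdeg m - 1\<close>.\<close>

lemma sphere_moment_add_single: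
  fixes m :: "'n::finite \<Rightarrow>\<^sub>0 nat"
  shows "sphere_moment (m + Poly_Mapping.single i 1) =
    of_nat (Poly_Mapping.lookup m i) / (of_nat CARD('n) + of_nat (mdeg m) - 1) *
    sphere_moment (m - Poly_Mapping.single i 1)"
proof (cases "Poly_Mapping.lookup m i = 0")
  \<comment> \<open>Both sides are 0, as the exponent of \<open>i\<close> on the left is 1. A zero
    denominator can occur only here, since it forces \<open>m = 0\<close>.\<close>
  case True
  then show ?thesis
    unfolding sphere_moment_def prod_gauss_moment_add_single by simp
next
  case False
  define m' where "m' = m - Poly_Mapping.single i 1"
  have m: "m = m' + Poly_Mapping.single i 1"
    using diff_single_add_single[of m i] False by (simp add: m'_def)
  have m2: "m + Poly_Mapping.single i 1 = m' + Poly_Mapping.single i 2"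
    unfolding m by (simp add: add.assoc numeral_2_eq_2 flip: single_add)
  have deg: "mdeg m = Suc (mdeg m')"
    unfolding m mdeg_add mdeg_single by simp
  have deg2: "mdeg (m' + Poly_Mapping.single i 2) = Suc (Suc (mdeg m'))"
    unfolding mdeg_add mdeg_single by simp
  have look: "Poly_Mapping.lookup m i = Suc (Poly_Mapping.lookup m' i)"
    by (simp add: m lookup_add)
  have prod: "(\<Prod>j\<in>UNIV. gauss_moment (Poly_Mapping.lookup m' j)) =
    gauss_moment (Poly_Mapping.lookup m' i) *
    (\<Prod>j\<in>UNIV-{i}. gauss_moment (Poly_Mapping.lookup m' j))"
    by (simp add: prod.remove)
  show ?thesis
    unfolding m2 sphere_moment_def prod_gauss_moment_add_single m'_def[symmetric] deg2 deg look prod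
    by (simp add: numeral_2_eq_2)
qed

text \<open>The moments are rational, so \<open>\<iota>\<close> carries them into \<open>R\<close>
  and no integration is involved.\<close>

definition sphere_mean :: "(rat \<Rightarrow> 'r) \<Rightarrow> ('n::finite, 'r::comm_ring_1) mpoly \<Rightarrow> 'r" where
  "sphere_mean \<iota> p =
    (\<Sum>m\<in>Poly_Mapping.keys p. Poly_Mapping.lookup p m * \<iota> (sphere_moment m))"

lemma sphere_mean_zero [simp]: "sphere_mean \<iota> 0 = 0"
  by (simp add: sphere_mean_def)

lemma sphere_mean_single:
  "sphere_mean \<iota> (Poly_Mapping.single m c) = c * \<iota> (sphere_moment m)"
  by (simp add: sphere_mean_def)

lemma sphere_mean_add: "sphere_mean \<iota> (p + q) = sphere_mean \<iota> p + sphere_mean \<iota> q"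
  unfolding sphere_mean_def by (rule setsum_keys_plus_distrib) (auto simp: distrib_right)

lemma sphere_mean_diff: "sphere_mean \<iota> (p - q) = sphere_mean \<iota> p - sphere_mean \<iota> q"
  using sphere_mean_add[of \<iota> "p - q" q] by simp

lemma sphere_mean_sum: "sphere_mean \<iota> (\<Sum>x\<in>A. f x) = (\<Sum>x\<in>A. sphere_mean \<iota> (f x))"
  by (induction A rule: infinite_finite_induct) (auto simp: sphere_mean_add)

lemma sphere_mean_scale: "sphere_mean \<iota> (Poly_Mapping.single 0 c * p) = c * sphere_mean \<iota> p"
  by (induction p rule: poly_mapping_single_induct)
    (auto simp: sphere_mean_add sphere_mean_single mult_single algebra_simps)

lemma sphere_mean_Var_mult:
  fixes p :: "('n::finite, 'r::comm_ring_1) mpoly"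
  assumes \<iota>: "rat_embedding \<iota>" and p: "homogeneous d p"
  shows "sphere_mean \<iota> (Var i * p) =
    \<iota> (1 / (of_nat CARD('n) + of_nat d - 1)) * sphere_mean \<iota> (pd i p)"
  using p
proof (induction rule: homogeneous_induct)
  case (single m c)
  let ?a = "1 / (of_nat CARD('n) + of_nat d - 1)"
  have "sphere_moment (m + Poly_Mapping.single i 1) =
    ?a * (of_nat (Poly_Mapping.lookup m i) * sphere_moment (m - Poly_Mapping.single i 1))"
    using sphere_moment_add_single[of m i] single by simp
  also have "\<iota> \<dots> = \<iota> ?a * (of_nat (Poly_Mapping.lookup m i) *
      \<iota> (sphere_moment (m - Poly_Mapping.single i 1)))"
    using \<iota> rat_embedding_of_nat[OF \<iota>, of "Poly_Mapping.lookup m i"]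
    unfolding rat_embedding_def by metis
  finally show ?case
    by (simp add: Var_def mult_single pd_single sphere_mean_single algebra_simps)
qed (auto simp: pd_add sphere_mean_add algebra_simps)

text \<open>For a monomial both first derivatives are homogeneous of the same degree, so the two
  products acquire the same scalar in front of equal mixed second derivatives.\<close>

lemma sphere_mean_M:
  assumes "rat_embedding \<iota>"
  shows "sphere_mean \<iota> (M j k p) = 0"
proof (induction p rule: poly_mapping_single_induct)
  case (single m c)
  have "homogeneous (mdeg m - 1) (pd i (Poly_Mapping.single m c))" for i
    by (intro homogeneous_pd homogeneous_single refl)
  from sphere_mean_Var_mult[OF assms this] show ?case
    by (simp only: M_def sphere_mean_diff pd_commute[of j k] diff_self)
qed (auto simp: M_def pd_add algebra_simps sphere_mean_diff sphere_mean_add)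

lemma sphere_mean_r2_power:
  assumes \<iota>: "rat_embedding \<iota>"
  shows "sphere_mean \<iota> ((r2 :: ('n::finite, 'r::comm_ring_1) mpoly) ^ n) = 1"
proof (induction n)
  case 0
  show ?case
    using \<iota> sphere_mean_single[of \<iota> 0 1]
    by (simp add: sphere_moment_def rat_embedding_def)
next
  case (Suc n)
  let ?P = "r2 ^ n :: ('n, 'r) mpoly"
  let ?a = "\<iota> (1 / of_nat (CARD('n) + n * 2))"
  have hom: "homogeneous (1 + n * 2) (Var j * ?P)" for j
    by (intro homogeneous_mult homogeneous_Var homogeneous_r2)
  have "sphere_mean \<iota> (r2 ^ Suc n :: ('n, 'r) mpoly) =
      (\<Sum>j\<in>UNIV. sphere_mean \<iota> (Var j * (Var j * ?P)))"
    by (simp add: sum_distrib_right sphere_mean_sum power2_eq_square mult.assoc)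
  \<comment> \<open>One factor \<open>Var j\<close> is traded for a derivative; the rest has degree
    \<open>2n + 1\<close>, whence the scalar \<open>1 / (N + 2n)\<close>.\<close>
  also have "\<dots> = ?a * sphere_mean \<iota> (\<Sum>j\<in>UNIV. pd j (Var j * ?P))"
    by (simp only: sphere_mean_Var_mult[OF \<iota> hom] sphere_mean_sum sum_distrib_left) simp
  \<comment> \<open>The product rule gives \<open>N\<close> copies of \<open>?P\<close> and Euler's
    identity \<open>2n\<close> more, which cancels the scalar \<open>?a\<close>.\<close>
  also have "(\<Sum>j\<in>UNIV. pd j (Var j * ?P)) = of_nat CARD('n) * ?P + (\<Sum>j\<in>UNIV. Var j * pd j ?P)"
    by (simp add: pd_mult pd_Var sum.distrib)
  also have "\<dots> = Poly_Mapping.single 0 (of_nat (CARD('n) + n * 2)) * ?P"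
    unfolding euler_identity[OF homogeneous_r2]
    unfolding single_of_nat by (simp only: of_nat_add distrib_right)
  also have "?a * sphere_mean \<iota> \<dots> = ?a * of_nat (CARD('n) + n * 2) * sphere_mean \<iota> ?P"
    unfolding sphere_mean_scale by (simp add: mult.assoc)
  also have "\<dots> = 1"
    unfolding Suc by (subst rat_embedding_inverse[OF \<iota>]) auto
  finally show ?case .
qed

lemma is_lambda0_sphere_mean:
  assumes "rat_embedding \<iota>"
  shows "is_lambda0 (sphere_mean \<iota>)"
proof -
  have "module_hom smult (*) (sphere_mean \<iota>)"
    by unfold_locales
      (simp_all add: smult_def sphere_mean_add sphere_mean_scale distrib_left distrib_right
        single_add mult_single mult.assoc[symmetric])
  then show ?thesis
    using assms by (simp add: is_lambda0_def sphere_mean_M sphere_mean_r2_power)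
qed

theorem proposition4p5:
  fixes \<iota> :: "rat \<Rightarrow> 'r::comm_ring_1"
    and p :: "('n::finite, 'r) mpoly"
    and i :: 'n
    and d :: nat
  assumes "rat_embedding \<iota>"
    and "CARD('n) \<ge> 2"
    and "homogeneous d p"
  shows "lambda0 (Var i * p) =
    \<iota> (1 / (of_nat CARD('n) + of_nat d - 1)) * lambda0 (pd i p)"
proof -
  \<comment> \<open>Existence and uniqueness together identify the definite description with
    \<open>sphere_mean \<iota>\<close>, for which the formula is known.\<close>
  have eq: "lambda0 = (sphere_mean \<iota> :: ('n, 'r) mpoly \<Rightarrow> 'r)"
    unfolding lambda0_def
    using is_lambda0_sphere_mean[OF assms(1)] is_lambda0_unique[OF assms(1,2)]
    by (intro the_equality) blast+
  show ?thesis
    unfolding eq by (rule sphere_mean_Var_mult[OF assms(1,3)])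
qed

end
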